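(* Let $r\ge 3$ and $t>1$ be fixed integers. Then $$\mathrm{ex}_r(n,F(t,r))=t\binom{n}{r-1}+O(n^{r-2}).$$
   Context: Let $\mathcal K_r^{(r-1)}$ denote the complete $(r-1)$-uniform hypergraph on $r$ vertices. Let $\mathcal F$ be the $(r-1)$-graph on $t(r-1)+1$ vertices consisting of $t$ copies of $\mathcal K_r^{(r-1)}$ that pairwise intersect in exactly one common vertex (and are otherwise vertex-disjoint); it has $tr$ hyperedges. $F(t,r)$ is the $r$-graph obtained from $\mathcal F$ by adding to each of its $tr$ hyperedges one new vertex, where these $tr$ new vertices are distinct from each other and do not belong to $V(\mathcal F)$. $\mathrm{ex}_r(n,\mathcal G)$ denotes the maximum number of hyperedges in an $n$-vertex $r$-graph not containing $\mathcal G$ as a subhypergraph. *)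

theory Defs
  imports Main "HOL-Library.Landau_Symbols"
begin

definition is_rgraph :: "nat \<Rightarrow> nat \<Rightarrow> nat set set \<Rightarrow> bool" where
  "is_rgraph r n H \<longleftrightarrow> (\<forall>e\<in>H. e \<subseteq> {..<n} \<and> card e = r)"

definition contains_copy :: "nat set set \<Rightarrow> 'a set set \<Rightarrow> bool" where
  "contains_copy H G \<longleftrightarrow> (\<exists>f. inj_on f (\<Union>G) \<and> (\<forall>e\<in>G. f ` e \<in> H))"

definition ex_r :: "nat \<Rightarrow> nat \<Rightarrow> 'a set set \<Rightarrow> nat" where
  "ex_r r n G = Max {card H | H. is_rgraph r n H \<and> \<not> contains_copy H G}"

text \<open>Vertices of F(t,r): the common centre, private vertices Priv i j (j < r-1) of the
  i-th copy of K_r^(r-1), and pendant vertices Pend i v added to the edge of copy i missing v.\<close>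
datatype fvert = Ctr | Priv nat nat | Pend nat fvert

definition Kcopy :: "nat \<Rightarrow> nat \<Rightarrow> fvert set" where
  "Kcopy r i = insert Ctr {Priv i j | j. j < r - 1}"

definition Fgraph :: "nat \<Rightarrow> nat \<Rightarrow> fvert set set" where
  "Fgraph t r = {insert (Pend i v) (Kcopy r i - {v}) | i v. i < t \<and> v \<in> Kcopy r i}"

end

theory Submission
  imports Defs
begin

text \<open>Upper bound. In an \<open>F(t,r)\<close>-free \<open>r\<close>-graph call an \<open>(r-1)\<close>-set light if its degree is below a
  large constant, and let each light set distribute weight 1 equally among the edges containing it.
  The total weight is at most \<open>n choose (r-1)\<close>, so at most \<open>t (n choose (r-1))\<close> edges have weight
  at least \<open>1/t\<close>. The remaining edges cannot contain a large sunflower whose kernel is a single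
  vertex: suitable \<open>t\<close> of its petals would serve as the cores of a copy of \<open>F(t,r)\<close>, because weight
  below \<open>1/t\<close> leaves enough room to pick distinct pendant vertices. So all vertex links of these
  edges have bounded covering number, which forces their number to be \<open>O(n^(r-2))\<close>.

  Lower bound. Fix \<open>t\<close> vertices and take all edges meeting them exactly once. A set meeting every
  edge of \<open>F(t,r)\<close> exactly once has more than \<open>t\<close> elements.\<close>

section \<open>Combinatorial selection lemmas\<close>

text \<open>Greedy choice in reverse order: an index \<open>j\<close> whose set is at least as large
  as the whole index set is served last, when the other indices block fewer than
  \<open>card (X j)\<close> values. Assuming the condition for all subfamilies lets the induction
  continue.\<close>

lemma injective_choice_if_large_member:
  assumes "finite I" and "\<And>J. J \<subseteq> I \<Longrightarrow> J \<noteq> {} \<Longrightarrow> \<exists>j\<in>J. card J \<le> card (X j)"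
  shows "\<exists>p. inj_on p I \<and> (\<forall>i\<in>I. p i \<in> X i)"
  using assms
proof (induction "card I" arbitrary: I)
  case 0
  then show ?case by simp
next
  case (Suc m)
  then have "I \<noteq> {}" by auto
  then obtain j where j: "j \<in> I" "card I \<le> card (X j)" using Suc.prems by blast
  have "\<exists>p. inj_on p (I - {j}) \<and> (\<forall>i\<in>I - {j}. p i \<in> X i)"
  proof (rule Suc.hyps(1))
    show "m = card (I - {j})" using Suc.hyps(2) j(1) by simp
    show "finite (I - {j})" using Suc.prems(1) by simp
    show "\<exists>i\<in>J. card J \<le> card (X i)" if "J \<subseteq> I - {j}" "J \<noteq> {}" for J
      using Suc.prems(2)[of J] that by blast
  qed
  then obtain p where p: "inj_on p (I - {j})" "\<forall>i\<in>I - {j}. p i \<in> X i" by blast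
  have "card (p ` (I - {j})) < card I"
    using card_image_le[of "I - {j}" p] Suc.prems(1) j(1) card_Diff1_less[of I j] by force
  then have "\<not> X j \<subseteq> p ` (I - {j})"
    using card_mono[of "p ` (I - {j})" "X j"] Suc.prems(1) j(2) by auto
  then obtain y where y: "y \<in> X j" "y \<notin> p ` (I - {j})" by blast
  have "inj_on (p(j := y)) I" using p(1) y(2) by (auto simp: inj_on_def)
  moreover have "\<forall>i\<in>I. (p(j := y)) i \<in> X i" using p(2) y(1) by auto
  ultimately show ?case by blast
qed

text \<open>Bounded out-degree forces an average in-degree of at most \<open>d\<close>, so some
  vertex has in-degree at most \<open>d\<close>. Keeping it and discarding its in- and
  out-neighbours uses up at most \<open>2 * d + 1\<close> vertices per chosen one.\<close>

lemma sparse_digraph_independent_set: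
  fixes N :: "'a \<Rightarrow> 'a set"
  assumes "finite V" and "\<And>v. v \<in> V \<Longrightarrow> card (N v \<inter> V) \<le> d"
    and "t * (2 * d + 1) \<le> card V"
  shows "\<exists>I\<subseteq>V. card I = t \<and> (\<forall>u\<in>I. \<forall>v\<in>I. u \<noteq> v \<longrightarrow> v \<notin> N u)"
  using assms
proof (induction t arbitrary: V)
  case 0
  then show ?case by (intro exI[of _ "{}"]) auto
next
  case (Suc t)
  have ne: "V \<noteq> {}" using Suc.prems by auto
  have "\<exists>v\<in>V. card {u\<in>V. v \<in> N u} \<le> d"
  proof (rule ccontr)
    assume "\<not> ?thesis"
    then have "(\<Sum>v\<in>V. d) < (\<Sum>v\<in>V. card {u\<in>V. v \<in> N u})"
      using ne Suc.prems(1) by (intro sum_strict_mono) auto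
    also have "\<dots> = (\<Sum>u\<in>V. card {v\<in>V. v \<in> N u})"
      using Suc.prems(1) by (intro sum_multicount_gen) auto
    also have "\<dots> \<le> (\<Sum>u\<in>V. d)"
    proof (rule sum_mono)
      fix u assume "u \<in> V"
      moreover have "{v\<in>V. v \<in> N u} = N u \<inter> V" by auto
      ultimately show "card {v\<in>V. v \<in> N u} \<le> d" using Suc.prems(2) by simp
    qed
    finally show False by simp
  qed
  then obtain v where v: "v \<in> V" "card {u\<in>V. v \<in> N u} \<le> d" by blast
  define R where "R = insert v ((N v \<inter> V) \<union> {u\<in>V. v \<in> N u})"
  have R: "R \<subseteq> V" using v by (auto simp: R_def)
  have finR: "finite R" using R Suc.prems(1) finite_subset by blast
  have "card R \<le> Suc (card ((N v \<inter> V) \<union> {u\<in>V. v \<in> N u}))"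
    unfolding R_def by (rule card_insert_le_m1) auto
  also have "\<dots> \<le> Suc (card (N v \<inter> V) + card {u\<in>V. v \<in> N u})"
    using card_Un_le by simp
  also have "\<dots> \<le> 2 * d + 1" using v Suc.prems(2)[OF v(1)] by simp
  finally have "card R \<le> 2 * d + 1" .
  then have "t * (2 * d + 1) \<le> card (V - R)"
    using card_Diff_subset[OF finR R] Suc.prems(3) by simp
  moreover have "card (N w \<inter> (V - R)) \<le> d" if "w \<in> V - R" for w
  proof -
    have "card (N w \<inter> (V - R)) \<le> card (N w \<inter> V)"
      using Suc.prems(1) by (intro card_mono) auto
    then show ?thesis using Suc.prems(2)[of w] that by auto
  qed
  ultimately obtain I where I: "I \<subseteq> V - R" "card I = t"
      "\<forall>u\<in>I. \<forall>v\<in>I. u \<noteq> v \<longrightarrow> v \<notin> N u"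
    using Suc.IH[of "V - R"] Suc.prems(1) by auto
  have "finite I" using I(1) Suc.prems(1) finite_subset by blast
  moreover have "v \<notin> I" using I(1) by (auto simp: R_def)
  ultimately have "card (insert v I) = Suc t" using I(2) by simp
  moreover have "insert v I \<subseteq> V" using I(1) v(1) by auto
  moreover have "\<forall>u\<in>insert v I. \<forall>w\<in>insert v I. u \<noteq> w \<longrightarrow> w \<notin> N u"
    using I(1,3) by (auto simp: R_def)
  ultimately show ?case by blast
qed

text \<open>If a matching of size \<open>M\<close> cannot be enlarged, its union meets every member
  of \<open>L\<close> and has at most \<open>M * k\<close> points.\<close>

lemma matching_or_small_cover:
  assumes "\<And>e. e \<in> L \<Longrightarrow> finite e \<and> e \<noteq> {} \<and> card e \<le> k"
  shows "(\<exists>P\<subseteq>L. finite P \<and> card P = M \<and> pairwise disjnt P) \<or>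
    (\<exists>T. finite T \<and> card T \<le> M * k \<and> (\<forall>e\<in>L. e \<inter> T \<noteq> {}))"
proof (induction M)
  case 0
  then show ?case by (intro disjI1 exI[of _ "{}"]) auto
next
  case (Suc M)
  show ?case
  proof (cases "\<exists>P\<subseteq>L. finite P \<and> card P = M \<and> pairwise disjnt P")
    case True
    then obtain P where P: "P \<subseteq> L" "finite P" "card P = M" "pairwise disjnt P" by blast
    show ?thesis
    proof (cases "\<forall>e\<in>L. e \<inter> \<Union>P \<noteq> {}")
      case True
      have "finite (\<Union>P)" using P(1,2) assms by blast
      moreover have "card (\<Union>P) \<le> M * k"
      proof -
        have "card (\<Union>P) \<le> (\<Sum>e\<in>P. card e)" by (rule card_Union_le_sum_card)
        also have "\<dots> \<le> card P * k" using P(1) assms sum_bounded_above[of P card k] by auto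
        finally show ?thesis using P(3) by simp
      qed
      ultimately show ?thesis using True by (intro disjI2 exI[of _ "\<Union>P"]) auto
    next
      case False
      then obtain e where e: "e \<in> L" "e \<inter> \<Union>P = {}" by blast
      have "e \<notin> P" using e assms by blast
      then have "card (insert e P) = Suc M" using P by simp
      moreover have "pairwise disjnt (insert e P)"
        using P(4) e(2) by (auto simp: pairwise_insert disjnt_def)
      ultimately show ?thesis using P e by (intro disjI1 exI[of _ "insert e P"]) auto
    qed
  next
    case False
    then show ?thesis using Suc by (auto intro: le_trans)
  qed
qed

text \<open>Each member meeting \<open>A\<close> claims one of its points there, and disjoint
  members cannot claim the same point.\<close>

lemma card_disjoint_family_meeting_le:
  assumes "pairwise disjnt P" and "finite A"
  shows "card {q\<in>P. q \<inter> A \<noteq> {}} \<le> card A"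
proof -
  define g where "g q = (SOME a. a \<in> q \<inter> A)" for q
  have g: "g q \<in> q \<inter> A" if "q \<inter> A \<noteq> {}" for q
    unfolding g_def using that by (meson ex_in_conv someI_ex)
  show ?thesis
  proof (rule card_inj_on_le[of g])
    show "inj_on g {q\<in>P. q \<inter> A \<noteq> {}}"
    proof (rule inj_onI)
      fix q q' assume *: "q \<in> {q\<in>P. q \<inter> A \<noteq> {}}" "q' \<in> {q\<in>P. q \<inter> A \<noteq> {}}" "g q = g q'"
      then have "g q \<in> q \<inter> q'" using g[of q] g[of q'] by auto
      then show "q = q'" using * assms(1) by (auto simp: pairwise_def disjnt_def)
    qed
    show "g ` {q\<in>P. q \<inter> A \<noteq> {}} \<subseteq> A" using g by blast
  qed (rule assms)
qed

section \<open>Uniform families whose links have bounded covering number\<close>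

text \<open>Viewing \<open>y \<in> T x\<close> as an arc from \<open>x\<close> to \<open>y\<close>, every vertex of an edge has an out-neighbour inside
  the edge. Hence the edge contains either a directed path on three vertices or two disjoint
  2-cycles, so two of its vertices are determined, up to boundedly many choices, by the others.\<close>

lemma edge_generated_by_all_but_two:
  assumes "card e \<ge> 3" and "\<And>x. x \<in> e \<Longrightarrow> \<exists>y\<in>e. y \<noteq> x \<and> y \<in> T x"
  obtains S a b where "e = insert b (insert a S)" "a \<noteq> b" "a \<notin> S" "b \<notin> S"
    "a \<in> \<Union>(T ` S)" "b \<in> \<Union>(T ` insert a S)"
proof -
  obtain f where f: "\<And>x. x \<in> e \<Longrightarrow> f x \<in> e \<and> f x \<noteq> x \<and> f x \<in> T x"
    using assms(2) by metis
  note result = that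
  have thesis if "u \<in> e" "f (f u) \<noteq> u" for u
    using that f[of u] f[of "f u"] by (intro result[of "f (f u)" "f u" "e - {f u, f (f u)}"]) auto
  moreover have thesis if inv: "\<And>u. u \<in> e \<Longrightarrow> f (f u) = u"
  proof -
    obtain u where u: "u \<in> e" using assms(1) by fastforce
    \<comment> \<open>Here \<open>f\<close> pairs up the vertices of \<open>e\<close>, so a third
      vertex forces a second pair disjoint from \<open>{u, f u}\<close>. One vertex of each pair is
      dropped, and its partner in \<open>S\<close> generates it.\<close>
    have "\<not> e \<subseteq> {u, f u}"
      using assms(1) card_mono[of "{u, f u}" e] card_insert_le_m1[of 2 "{f u}" u] by auto
    then obtain v where v: "v \<in> e" "v \<noteq> u" "v \<noteq> f u" by blast
    have "f v \<noteq> u" "f v \<noteq> f u" using inv u v by metis+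
    then show thesis
      using u v f[of u] f[of v]
      by (intro result[of "f v" "f u" "e - {f u, f v}"]) auto
  qed
  ultimately show thesis by blast
qed

text \<open>Each edge is encoded by a triple \<open>(S, a, b)\<close>. There are
  \<open>n choose (r - 2)\<close> sets \<open>S\<close>, and \<open>a\<close> and \<open>b\<close>
  each lie in a union of at most \<open>r\<close> sets \<open>T x\<close>, which leaves at most
  \<open>r * \<tau>\<close> choices for either.\<close>

lemma card_le_if_links_covered:
  fixes B :: "nat set set"
  assumes "r \<ge> 3" and "is_rgraph r n B" and "\<And>x. finite (T x) \<and> card (T x) \<le> \<tau>"
    and cov: "\<And>e x. e \<in> B \<Longrightarrow> x \<in> e \<Longrightarrow> \<exists>y\<in>e. y \<noteq> x \<and> y \<in> T x"
  shows "card B \<le> (n choose (r - 2)) * ((r * \<tau>) * (r * \<tau>))"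
proof -
  define \<S> where "\<S> = {S. S \<subseteq> {..<n} \<and> card S = r - 2}"
  define W where "W S = (SIGMA a:\<Union>(T ` S). \<Union>(T ` insert a S))" for S
  have T_UN: "finite (\<Union>(T ` S)) \<and> card (\<Union>(T ` S)) \<le> r * \<tau>" if "finite S" "card S \<le> r" for S
  proof -
    have "card (\<Union>(T ` S)) \<le> (\<Sum>s\<in>S. card (T s))" using that(1) by (rule card_UN_le)
    also have "\<dots> \<le> card S * \<tau>" using assms(3) sum_bounded_above[of S "\<lambda>s. card (T s)" \<tau>] by auto
    also have "\<dots> \<le> r * \<tau>" using that(2) by simp
    finally show ?thesis using that(1) assms(3) by auto
  qed
  have finS: "finite \<S>" unfolding \<S>_def by (rule finite_subset[of _ "Pow {..<n}"]) auto
  have S: "finite S" "card S \<le> r" "card (insert a S) \<le> r" if "S \<in> \<S>" for S a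
    using that assms(1) finite_subset[of S "{..<n}"] card_insert_le_m1[of r S a]
    by (auto simp: \<S>_def)
  have W: "finite (W S) \<and> card (W S) \<le> (r * \<tau>) * (r * \<tau>)" if "S \<in> \<S>" for S
  proof -
    have fin: "finite (\<Union>(T ` S))" "card (\<Union>(T ` S)) \<le> r * \<tau>"
      using T_UN[of S] S[OF that] by auto
    have fin': "finite (\<Union>(T ` insert a S))" "card (\<Union>(T ` insert a S)) \<le> r * \<tau>" for a
      using T_UN[of "insert a S"] S[OF that] by auto
    have "card (W S) = (\<Sum>a\<in>\<Union>(T ` S). card (\<Union>(T ` insert a S)))"
      unfolding W_def using fin fin' by (intro card_SigmaI) auto
    also have "\<dots> \<le> card (\<Union>(T ` S)) * (r * \<tau>)"
      using fin' sum_bounded_above[of "\<Union>(T ` S)" "\<lambda>a. card (\<Union>(T ` insert a S))" "r * \<tau>"] by auto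
    also have "\<dots> \<le> (r * \<tau>) * (r * \<tau>)" using fin(2) by (rule mult_le_mono1)
    finally show ?thesis unfolding W_def using fin fin' by auto
  qed
  have "B \<subseteq> (\<lambda>(S, a, b). insert b (insert a S)) ` Sigma \<S> W"
  proof
    fix e assume e: "e \<in> B"
    then have e': "e \<subseteq> {..<n}" "card e = r" using assms(2) by (auto simp: is_rgraph_def)
    obtain S a b where *: "e = insert b (insert a S)" "a \<noteq> b" "a \<notin> S" "b \<notin> S"
      "a \<in> \<Union>(T ` S)" "b \<in> \<Union>(T ` insert a S)"
      using edge_generated_by_all_but_two[of e T] cov[OF e] e'(2) assms(1) by metis
    have "finite S" using * e' finite_subset[of S "{..<n}"] by auto
    then have "card S = r - 2" using * e'(2) by auto
    then have "S \<in> \<S>" using * e' by (auto simp: \<S>_def)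
    then have "(S, a, b) \<in> Sigma \<S> W" using *(5,6) by (auto simp: W_def)
    then show "e \<in> (\<lambda>(S, a, b). insert b (insert a S)) ` Sigma \<S> W"
      by (rule rev_image_eqI) (simp add: *(1))
  qed
  moreover have fin\<S>W: "finite (Sigma \<S> W)" using finS W by (intro finite_SigmaI) auto
  ultimately have "card B \<le> card (Sigma \<S> W)" by (rule surj_card_le[rotated])
  also have "\<dots> = (\<Sum>S\<in>\<S>. card (W S))" using finS W by (intro card_SigmaI) auto
  also have "\<dots> \<le> card \<S> * ((r * \<tau>) * (r * \<tau>))"
    using W sum_bounded_above[of \<S> "\<lambda>S. card (W S)" "(r * \<tau>) * (r * \<tau>)"] by auto
  also have "card \<S> = n choose (r - 2)" unfolding \<S>_def using n_subsets[of "{..<n}"] by simp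
  finally show ?thesis .
qed

section \<open>Copies of F(t,r)\<close>

text \<open>The size of \<open>nbrs H f\<close> is the degree of \<open>f\<close>, the quantity that
  separates light sets from heavy ones.\<close>

definition nbrs :: "'a set set \<Rightarrow> 'a set \<Rightarrow> 'a set" where
  "nbrs H f = {y. y \<notin> f \<and> insert y f \<in> H}"

text \<open>The \<open>i\<close>-th clique is placed on \<open>e i\<close> with its centre at
  \<open>x\<close>, and \<open>p (i, u)\<close> serves as the pendant vertex of the clique edge
  missing \<open>u\<close>. Finding a copy is thus reduced to choosing the cores and an injective
  \<open>p\<close>.\<close>

lemma contains_copy_FgraphI:
  fixes e :: "nat \<Rightarrow> nat set" and p :: "nat \<times> nat \<Rightarrow> nat"
  assumes "r > 0"
    and card_e: "\<And>i. i < t \<Longrightarrow> card (e i) = r"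
    and x: "\<And>i. i < t \<Longrightarrow> x \<in> e i"
    and meet: "\<And>i j. i < t \<Longrightarrow> j < t \<Longrightarrow> i \<noteq> j \<Longrightarrow> e i \<inter> e j = {x}"
    and p_inj: "inj_on p (SIGMA i:{..<t}. e i)"
    and p_new: "\<And>i j u. i < t \<Longrightarrow> j < t \<Longrightarrow> u \<in> e i \<Longrightarrow> p (i, u) \<notin> e j"
    and p_edge: "\<And>i u. i < t \<Longrightarrow> u \<in> e i \<Longrightarrow> insert (p (i, u)) (e i - {u}) \<in> H"
  shows "contains_copy H (Fgraph t r)"
proof -
  have "\<exists>h. bij_betw h {..<r - 1} (e i - {x})" if "i < t" for i
  proof -
    have "finite (e i)" using card_e[OF that] \<open>r > 0\<close> card_ge_0_finite[of "e i"] by simp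
    moreover have "card (e i - {x}) = r - 1" using card_e x that by simp
    ultimately show ?thesis
      using ex_bij_betw_nat_finite[of "e i - {x}"] by (metis finite_Diff lessThan_atLeast0)
  qed
  then obtain g where g: "\<And>i. i < t \<Longrightarrow> bij_betw (g i) {..<r - 1} (e i - {x})" by metis
  have g_in: "g i j \<in> e i" "g i j \<noteq> x" if "i < t" "j < r - 1" for i j
    using bij_betw_apply[OF g[OF that(1)]] that(2) by auto
  have g_eq: "i = i' \<and> j = j'"
    if "g i j = g i' j'" "i < t" "i' < t" "j < r - 1" "j' < r - 1" for i i' j j'
  proof -
    have "i = i'"
    proof (rule ccontr)
      assume "i \<noteq> i'"
      then show False using meet[of i i'] g_in[of i j] g_in[of i' j'] that by auto
    qed
    moreover have "j = j'"
      using that g[of i] \<open>i = i'\<close> by (auto simp: bij_betw_def inj_on_def)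
    ultimately show ?thesis by blast
  qed
  define core where "core v = (case v of Ctr \<Rightarrow> x | Priv i j \<Rightarrow> g i j | Pend _ _ \<Rightarrow> x)" for v
  \<comment> \<open>A pendant vertex is placed according to the host vertex \<open>core w\<close> of
    the missing vertex \<open>w\<close>; reading it off from \<open>core\<close> avoids a recursion
    through \<open>Pend\<close>.\<close>
  define f where "f v = (case v of Pend i w \<Rightarrow> p (i, core w) | _ \<Rightarrow> core v)" for v
  have core_image: "core ` Kcopy r i = e i" if "i < t" for i
  proof -
    have "core ` Kcopy r i = insert x (g i ` {..<r - 1})"
      by (auto simp: Kcopy_def core_def setcompr_eq_image image_image)
    also have "\<dots> = e i" using g[OF that] x[OF that] by (auto simp: bij_betw_def)
    finally show ?thesis .
  qed
  have core_inj: "inj_on core (\<Union>i<t. Kcopy r i)"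
  proof (rule inj_onI)
    have form: "v = Ctr \<or> (\<exists>i j. v = Priv i j \<and> i < t \<and> j < r - 1)" if v: "v \<in> (\<Union>i<t. Kcopy r i)" for v
    proof -
      obtain i where "i < t" "v \<in> Kcopy r i" using v by blast
      then show ?thesis by (auto simp: Kcopy_def)
    qed
    fix v w assume vw: "v \<in> (\<Union>i<t. Kcopy r i)" "w \<in> (\<Union>i<t. Kcopy r i)" and eq: "core v = core w"
    show "v = w"
      using form[OF vw(1)] form[OF vw(2)]
    proof (elim disjE exE conjE)
      fix i j i' j'
      assume "v = Priv i j" "i < t" "j < r - 1" "w = Priv i' j'" "i' < t" "j' < r - 1"
      then show ?thesis using eq g_eq[of i j i' j'] by (simp add: core_def)
    qed (use eq g_in(2) in \<open>force simp: core_def\<close>)+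
  qed
  have core_f: "f v = core v" if "v \<in> Kcopy r i" for v i
    using that by (auto simp: Kcopy_def f_def)
  have verts: "\<Union>(Fgraph t r) \<subseteq> (\<Union>i<t. Kcopy r i) \<union> {Pend i v |i v. i < t \<and> v \<in> Kcopy r i}"
    by (auto simp: Fgraph_def)
  have pend: "f (Pend i v) = p (i, core v)" for i v by (simp add: f_def)
  have "inj_on f ((\<Union>i<t. Kcopy r i) \<union> {Pend i v |i v. i < t \<and> v \<in> Kcopy r i})"
  proof (subst inj_on_Un, intro conjI)
    show "inj_on f (\<Union>i<t. Kcopy r i)"
      using core_inj core_f by (auto simp: inj_on_def)
    show "inj_on f {Pend i v |i v. i < t \<and> v \<in> Kcopy r i}"
    proof (rule inj_onI, clarsimp simp: pend)
      fix i i' v v'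
      assume *: "p (i, core v) = p (i', core v')" "i < t" "i' < t" "v \<in> Kcopy r i" "v' \<in> Kcopy r i'"
      then have "core v \<in> e i" "core v' \<in> e i'" using core_image by blast+
      then have "i = i' \<and> core v = core v'" using * inj_onD[OF p_inj *(1)] by auto
      then show "i = i' \<and> v = v'" using * inj_onD[OF core_inj, of v v'] by auto
    qed
    have "f v \<noteq> f w" if "v \<in> Kcopy r i" "i < t" "w = Pend j u" "j < t" "u \<in> Kcopy r j" for v w i j u
    proof -
      have "f v \<in> e i" using core_f core_image that by blast
      moreover have "core u \<in> e j" using core_image that by blast
      ultimately show ?thesis using p_new[of j i "core u"] that pend by auto
    qed
    then show "f ` ((\<Union>i<t. Kcopy r i) - {Pend i v |i v. i < t \<and> v \<in> Kcopy r i}) \<inter>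
        f ` ({Pend i v |i v. i < t \<and> v \<in> Kcopy r i} - (\<Union>i<t. Kcopy r i)) = {}"
      by fastforce
  qed
  then have "inj_on f (\<Union>(Fgraph t r))" using verts by (rule inj_on_subset)
  moreover have "f ` E \<in> H" if E_F: "E \<in> Fgraph t r" for E
  proof -
    obtain i v where E: "E = insert (Pend i v) (Kcopy r i - {v})" "i < t" "v \<in> Kcopy r i"
      using E_F by (auto simp: Fgraph_def)
    have "f ` (Kcopy r i - {v}) = core ` (Kcopy r i - {v})"
      using core_f by (intro image_cong) auto
    also have "\<dots> = core ` Kcopy r i - core ` {v}"
      using inj_on_subset[OF core_inj, of "Kcopy r i"] E(2,3)
      by (intro inj_on_image_set_diff[of _ "Kcopy r i"]) auto
    finally have "f ` E = insert (p (i, core v)) (e i - {core v})"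
      using core_image[OF E(2)] E(1) pend by simp
    moreover have "core v \<in> e i" using core_image E by blast
    ultimately show ?thesis using p_edge[OF E(2)] by simp
  qed
  ultimately show ?thesis unfolding contains_copy_def by blast
qed

section \<open>Edge weights and the upper bound\<close>

text \<open>Every set of degree less than \<open>D\<close> distributes a total weight of at most 1 equally among the
  edges containing it. Isolated sets have weight \<open>1 / 0 = 0\<close>.\<close>

definition edge_weight :: "nat \<Rightarrow> 'a set set \<Rightarrow> 'a set \<Rightarrow> real" where
  "edge_weight D H e =
    (\<Sum>u | u \<in> e \<and> card (nbrs H (e - {u})) < D. 1 / card (nbrs H (e - {u})))"

lemma finite_nbrs:
  assumes "is_rgraph r n H"
  shows "finite (nbrs H f)"
  by (rule finite_subset[of _ "{..<n}"]) (use assms in \<open>auto simp: nbrs_def is_rgraph_def\<close>)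

lemma finite_rgraph: "is_rgraph r n H \<Longrightarrow> finite H"
  by (rule finite_subset[of _ "Pow {..<n}"]) (auto simp: is_rgraph_def)

lemma finite_edge: "is_rgraph r n H \<Longrightarrow> e \<in> H \<Longrightarrow> finite e"
  by (auto simp: is_rgraph_def intro: finite_subset)

text \<open>Double counting: the pairs \<open>(e, u)\<close> are grouped by the set
  \<open>f = e - {u}\<close>. Exactly \<open>card (nbrs H f)\<close> pairs belong to
  \<open>f\<close>, so their contributions add up to at most 1.\<close>

lemma sum_edge_weight_le:
  assumes "is_rgraph r n H" and "r > 0"
  shows "(\<Sum>e\<in>H. edge_weight D H e) \<le> real (n choose (r - 1))"
proof -
  define g where "g f = (if card (nbrs H f) < D then 1 / real (card (nbrs H f)) else 0)" for f
  define \<F> where "\<F> = {f. f \<subseteq> {..<n} \<and> card f = r - 1}"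
  define Z where "Z = (SIGMA e:H. e)"
  have fin: "finite H" "\<And>e. e \<in> H \<Longrightarrow> finite e" "finite \<F>" "finite Z"
    using finite_rgraph[OF assms(1)] finite_edge[OF assms(1)]
    by (auto simp: \<F>_def Z_def)
  have "(\<Sum>e\<in>H. edge_weight D H e) = (\<Sum>e\<in>H. \<Sum>u\<in>e. g (e - {u}))"
  proof (rule sum.cong)
    fix e assume "e \<in> H"
    then have "finite e" using fin by blast
    then show "edge_weight D H e = (\<Sum>u\<in>e. g (e - {u}))"
      unfolding edge_weight_def g_def by (subst sum.inter_filter[symmetric]) auto
  qed simp
  also have "\<dots> = (\<Sum>(e, u)\<in>Z. g (e - {u}))"
    unfolding Z_def using fin by (subst sum.Sigma) auto
  also have "\<dots> = (\<Sum>f\<in>\<F>. \<Sum>z\<in>{z\<in>Z. fst z - {snd z} = f}. g (fst z - {snd z}))"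
  proof (subst sum.group)
    show "(\<lambda>z. fst z - {snd z}) ` Z \<subseteq> \<F>"
      using assms(1) fin by (auto simp: Z_def \<F>_def is_rgraph_def)
  qed (use fin in \<open>auto simp: case_prod_beta\<close>)
  also have "\<dots> \<le> (\<Sum>f\<in>\<F>. 1)"
  proof (rule sum_mono)
    fix f
    have "{z\<in>Z. fst z - {snd z} = f} = (\<lambda>y. (insert y f, y)) ` nbrs H f"
      by (auto simp: Z_def nbrs_def image_iff insert_absorb)
    then have "card {z\<in>Z. fst z - {snd z} = f} = card (nbrs H f)"
      by (simp add: card_image inj_on_def)
    then have "(\<Sum>z\<in>{z\<in>Z. fst z - {snd z} = f}. g (fst z - {snd z})) = card (nbrs H f) * g f"
      by simp
    also have "\<dots> \<le> 1" by (simp add: g_def)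
    finally show "(\<Sum>z\<in>{z\<in>Z. fst z - {snd z} = f}. g (fst z - {snd z})) \<le> 1" .
  qed
  also have "\<dots> = real (n choose (r - 1))"
    unfolding \<F>_def using n_subsets[of "{..<n}"] by simp
  finally show ?thesis .
qed

text \<open>If \<open>k\<close> light subsets of a light-weight edge are given, then by averaging one of them has degree
  more than \<open>k t\<close>. This is exactly the room needed to choose all pendant vertices greedily.\<close>

lemma exists_large_degree_if_small_weight:
  assumes "edge_weight D H e < 1 / real t" and "t > 0" and "finite e"
    and "K \<subseteq> {u\<in>e. card (nbrs H (e - {u})) < D}" and "K \<noteq> {}"
    and pos: "\<And>u. u \<in> K \<Longrightarrow> card (nbrs H (e - {u})) > 0"
  shows "\<exists>u\<in>K. card K * t < card (nbrs H (e - {u}))"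
proof (rule ccontr)
  assume neg: "\<not> ?thesis"
  have finK: "finite K" using assms(3,4) finite_subset by fastforce
  then have K: "card K > 0" using assms(5) by (simp add: card_gt_0_iff)
  have "1 / real t = (\<Sum>u\<in>K. 1 / real (card K * t))"
    using K assms(2) by (simp add: field_simps)
  also have "\<dots> \<le> (\<Sum>u\<in>K. 1 / real (card (nbrs H (e - {u}))))"
  proof (rule sum_mono)
    fix u assume u: "u \<in> K"
    have "real (card (nbrs H (e - {u}))) \<le> real (card K * t)" 
      using neg u by (subst of_nat_le_iff) (auto simp: not_less)
    \<comment> \<open>Positive degrees matter here because \<open>1 / 0 = 0\<close>.\<close>
    then show "1 / real (card K * t) \<le> 1 / real (card (nbrs H (e - {u})))"
      using pos[OF u] by (intro divide_left_mono) (auto simp: K assms(2))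
  qed
  also have "\<dots> \<le> edge_weight D H e"
    unfolding edge_weight_def using assms(3,4) by (intro sum_mono2) auto
  finally show False using assms(1) by simp
qed

text \<open>The petals become the cores, and distinct pendant vertices outside all petals are found
  by the greedy choice. In a family of requests, a heavy set has enough free neighbours for all of
  them; if all sets are light, the small weight of a petal with many requests provides a set of
  sufficient degree.\<close>

lemma contains_copy_if_sunflower:
  fixes e :: "nat \<Rightarrow> nat set"
  assumes H: "is_rgraph r n H" and "t > 0"
    and e_H: "\<And>i. i < t \<Longrightarrow> e i \<in> H"
    and weight: "\<And>i. i < t \<Longrightarrow> edge_weight (2 * t * r) H (e i) < 1 / real t"
    and x: "\<And>i. i < t \<Longrightarrow> x \<in> e i"
    and meet: "\<And>i j. i < t \<Longrightarrow> j < t \<Longrightarrow> i \<noteq> j \<Longrightarrow> e i \<inter> e j = {x}"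
    and avoid: "\<And>i j u. i < t \<Longrightarrow> j < t \<Longrightarrow> i \<noteq> j \<Longrightarrow> u \<in> e i \<Longrightarrow>
      card (nbrs H (e i - {u})) < 2 * t * r \<Longrightarrow> nbrs H (e i - {u}) \<inter> e j \<subseteq> e i"
  shows "contains_copy H (Fgraph t r)"
proof -
  have card_e: "card (e i) = r" "finite (e i)" if "i < t" for i
    using e_H[OF that] H finite_edge[OF H] by (auto simp: is_rgraph_def)
  have "r > 0" using card_e[of 0] x[of 0] \<open>t > 0\<close> card_gt_0_iff by blast
  define C where "C = (\<Union>i<t. e i)"
  define X where "X = (\<lambda>(i, u). nbrs H (e i - {u}) - C)"
  have "card C \<le> (\<Sum>i<t. card (e i))" unfolding C_def by (rule card_UN_le) simp
  then have C: "finite C" "card C \<le> t * r" using card_e by (auto simp: C_def)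
  have finZ: "finite (SIGMA i:{..<t}. e i)" using card_e by auto
  have cardZ: "card (SIGMA i:{..<t}. e i) = t * r" using card_e by (subst card_SigmaI) auto
  \<comment> \<open>At most \<open>t * r\<close> vertices lie in \<open>C\<close>, so at least half
    of the threshold \<open>2 * t * r\<close> survives its removal.\<close>
  have heavy: "t * r \<le> card (X (i, u))" if "2 * t * r \<le> card (nbrs H (e i - {u}))" for i u
    using that C diff_card_le_card_Diff[OF C(1), of "nbrs H (e i - {u})"] by (simp add: X_def)
  have own: "u \<in> nbrs H (e i - {u})" if "i < t" "u \<in> e i" for i u
    using that e_H by (auto simp: nbrs_def insert_absorb)
  \<comment> \<open>By \<open>avoid\<close>, the only neighbour lost to \<open>C\<close> is
    \<open>u\<close> itself, which comes from the edge \<open>e i\<close>.\<close>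
  have light: "card (nbrs H (e i - {u})) = Suc (card (X (i, u)))"
    if "i < t" "u \<in> e i" "card (nbrs H (e i - {u})) < 2 * t * r" for i u
  proof -
    have "nbrs H (e i - {u}) \<inter> C \<subseteq> e i" using avoid[OF that(1) _ _ that(2,3)] by (auto simp: C_def)
    moreover have "nbrs H (e i - {u}) \<inter> e i \<subseteq> {u}" by (auto simp: nbrs_def)
    ultimately have "X (i, u) = nbrs H (e i - {u}) - {u}"
      using that by (auto simp: X_def C_def)
    then show ?thesis
      using card.remove[OF finite_nbrs[OF H] own[OF that(1,2)]] by simp
  qed
  have "\<exists>p. inj_on p (SIGMA i:{..<t}. e i) \<and> (\<forall>z\<in>SIGMA i:{..<t}. e i. p z \<in> X z)"
  proof (rule injective_choice_if_large_member[OF finZ])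
    fix J assume J: "J \<subseteq> (SIGMA i:{..<t}. e i)" "J \<noteq> {}"
    have finJ: "finite J" using J(1) finZ finite_subset by blast
    have cardJ: "card J \<le> t * r" using card_mono[OF finZ J(1)] cardZ by simp
    show "\<exists>j\<in>J. card J \<le> card (X j)"
    proof (cases "\<exists>(i, u)\<in>J. 2 * t * r \<le> card (nbrs H (e i - {u}))")
      case True
      then show ?thesis using heavy cardJ by (fastforce intro: le_trans)
    next
      case False
      define K where "K i = {u. (i, u) \<in> J}" for i
      have J_eq: "J = (SIGMA i:{..<t}. K i)" using J(1) by (auto simp: K_def)
      have finK: "finite (K i)" for i
        by (rule finite_subset[of _ "snd ` J"]) (use finJ in \<open>force simp: K_def\<close>)+
      \<comment> \<open>Pigeonhole over the \<open>t\<close> petals: one of them carries at least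
        the average number of requests.\<close>
      have "\<exists>i<t. card J \<le> card (K i) * t"
      proof (rule ccontr)
        assume "\<not> ?thesis"
        then have "(\<Sum>i<t. card (K i) * t) < (\<Sum>i<t. card J)"
          using \<open>t > 0\<close> by (intro sum_strict_mono) auto
        moreover have "(\<Sum>i<t. card (K i) * t) = card J * t"
          using finK by (subst J_eq) (simp add: sum_distrib_right)
        ultimately show False by simp
      qed
      then obtain i where i: "i < t" "card J \<le> card (K i) * t" by blast
      have "card J > 0" using J(2) finJ by (simp add: card_gt_0_iff)
      then have Ki: "K i \<noteq> {}" using i(2) by auto
      have sub: "K i \<subseteq> {u\<in>e i. card (nbrs H (e i - {u})) < 2 * t * r}"
        using False J(1) by (force simp: K_def not_le)
      have "card (nbrs H (e i - {u})) > 0" if "u \<in> K i" for u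
        using that sub light[OF i(1), of u] by auto
      then obtain u where u: "u \<in> K i" "card (K i) * t < card (nbrs H (e i - {u}))"
        using exists_large_degree_if_small_weight[OF weight[OF i(1)] \<open>t > 0\<close> _ sub Ki] card_e(2)[OF i(1)]
        by blast
      \<comment> \<open>The strict inequality for \<open>u\<close> absorbs the loss of the single
        neighbour \<open>u\<close>.\<close>
      then have "card J \<le> card (X (i, u))" using i sub light[OF i(1), of u] by auto
      then show ?thesis using u(1) by (auto simp: K_def)
    qed
  qed
  then obtain p where p: "inj_on p (SIGMA i:{..<t}. e i)"
    "\<And>i u. i < t \<Longrightarrow> u \<in> e i \<Longrightarrow> p (i, u) \<in> X (i, u)" by auto
  show ?thesis
  proof (rule contains_copy_FgraphI[where e = e and x = x and p = p])
    show "p (i, u) \<notin> e j" if "i < t" "j < t" "u \<in> e i" for i j u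
      using p(2)[OF that(1,3)] that(2) by (auto simp: X_def C_def)
    show "insert (p (i, u)) (e i - {u}) \<in> H" if "i < t" "u \<in> e i" for i u
      using p(2)[OF that] by (auto simp: X_def nbrs_def)
  qed (use \<open>r > 0\<close> card_e x meet p(1) in auto)
qed

text \<open>The first factor is the size of a sunflower from which \<open>t\<close> petals with mutually avoiding light
  neighbourhoods can be selected; each petal has at most \<open>2 t r\<^sup>2\<close> light neighbours.\<close>

definition cover_bound :: "nat \<Rightarrow> nat \<Rightarrow> nat" where
  "cover_bound t r = t * (2 * (r * (2 * t * r)) + 1) * r"

text \<open>A matching in the link of \<open>x\<close> is a sunflower with kernel \<open>x\<close>.
  A matching of size \<open>M\<close> would yield a copy of \<open>Fgraph t r\<close>, so the link,
  formed from the edges of small weight, has a cover of at most \<open>M * r\<close>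
  vertices.\<close>

lemma light_edges_link_cover:
  fixes x :: nat
  assumes H: "is_rgraph r n H" and free: "\<not> contains_copy H (Fgraph t r)" and "r \<ge> 2" and "t > 0"
  shows "\<exists>T. finite T \<and> card T \<le> cover_bound t r \<and>
    (\<forall>e\<in>H. edge_weight (2 * t * r) H e < 1 / real t \<longrightarrow> x \<in> e \<longrightarrow> (\<exists>y\<in>e. y \<noteq> x \<and> y \<in> T))"
proof -
  define B where "B = {e\<in>H. edge_weight (2 * t * r) H e < 1 / real t \<and> x \<in> e}"
  define L where "L = (\<lambda>e. e - {x}) ` B"
  define d where "d = r * (2 * t * r)"
  define M where "M = t * (2 * d + 1)"
  have L: "insert x q \<in> B" "x \<notin> q" if "q \<in> L" for q
    using that by (auto simp: L_def B_def insert_absorb)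
  have sizeL: "finite q \<and> q \<noteq> {} \<and> card q \<le> r" if "q \<in> L" for q
  proof -
    have "finite (insert x q)" "card (insert x q) = r"
      using L[OF that] H finite_edge[OF H, of "insert x q"] by (auto simp: B_def is_rgraph_def)
    then show ?thesis using L(2)[OF that] \<open>r \<ge> 2\<close> by auto
  qed
  have no_matching: False if P: "P \<subseteq> L" "finite P" "card P = M" "pairwise disjnt P" for P
  proof -
    \<comment> \<open>\<open>A q\<close> collects the neighbours of all light subsets of the edge
      \<open>insert x q\<close>; petals disjoint from it satisfy the avoidance condition for
      \<open>q\<close>.\<close>
    define A where "A q = (\<Union>u\<in>{u\<in>insert x q. card (nbrs H (insert x q - {u})) < 2 * t * r}.
      nbrs H (insert x q - {u}))" for q
    have A: "finite (A q)" "card (A q) \<le> d" if "q \<in> P" for q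
    proof -
      define U where "U = {u\<in>insert x q. card (nbrs H (insert x q - {u})) < 2 * t * r}"
      have q: "finite (insert x q)" "card (insert x q) = r"
        using L[of q] that P(1) H finite_edge[OF H, of "insert x q"] by (auto simp: B_def is_rgraph_def)
      then have U: "finite U" "card U \<le> r"
        using card_mono[of "insert x q" U] by (auto simp: U_def)
      have "card (A q) \<le> (\<Sum>u\<in>U. card (nbrs H (insert x q - {u})))"
        unfolding A_def U_def[symmetric] using U(1) by (rule card_UN_le)
      also have "\<dots> \<le> card U * (2 * t * r)"
        using sum_bounded_above[of U "\<lambda>u. card (nbrs H (insert x q - {u}))" "2 * t * r"]
        by (auto simp: U_def)
      also have "\<dots> \<le> d" unfolding d_def using U(2) by (rule mult_le_mono1)
      finally show "card (A q) \<le> d" .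
      show "finite (A q)" unfolding A_def U_def[symmetric] using U(1) finite_nbrs[OF H] by blast
    qed
    have "card ({q'. q' \<inter> A q \<noteq> {}} \<inter> P) \<le> d" if "q \<in> P" for q
    proof -
      have "{q'. q' \<inter> A q \<noteq> {}} \<inter> P = {q'\<in>P. q' \<inter> A q \<noteq> {}}" by auto
      then show ?thesis
        using card_disjoint_family_meeting_le[OF P(4) A(1)[OF that]] A(2)[OF that] by simp
    qed
    \<comment> \<open>In the digraph with an arc from \<open>q\<close> to each petal meeting
      \<open>A q\<close>, out-degrees are at most \<open>d\<close> because the petals are disjoint.
      Independent petals avoid each other's light neighbours.\<close>
    then obtain I where I: "I \<subseteq> P" "card I = t"
        "\<And>q q'. q \<in> I \<Longrightarrow> q' \<in> I \<Longrightarrow> q \<noteq> q' \<Longrightarrow> q' \<inter> A q = {}"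
      using sparse_digraph_independent_set[OF P(2), of "\<lambda>q. {q'. q' \<inter> A q \<noteq> {}}" d t] P(3)
      unfolding M_def by auto
    obtain h where h: "bij_betw h {..<t} I"
      using ex_bij_betw_nat_finite[of I] I(1,2) P(2) finite_subset lessThan_atLeast0 by metis
    have hI: "h i \<in> I" "h i \<in> P" "h i \<in> L" if "i < t" for i
      using bij_betw_apply[OF h] that I(1) P(1) by auto
    have h_neq: "h i \<noteq> h j" if "i < t" "j < t" "i \<noteq> j" for i j
      using h that by (auto simp: bij_betw_def inj_on_def)
    have "contains_copy H (Fgraph t r)"
    proof (rule contains_copy_if_sunflower[OF H \<open>t > 0\<close>, of "\<lambda>i. insert x (h i)" x])
      fix i assume i: "i < t"
      show "insert x (h i) \<in> H" "edge_weight (2 * t * r) H (insert x (h i)) < 1 / real t"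
        using L(1)[OF hI(3)[OF i]] by (auto simp: B_def)
      fix j assume j: "j < t" "i \<noteq> j"
      have "h i \<inter> h j = {}"
        using P(4) hI(2) i j h_neq[OF i j] by (auto simp: pairwise_def disjnt_def)
      then show "insert x (h i) \<inter> insert x (h j) = {x}" by auto
      fix u assume u: "u \<in> insert x (h i)" "card (nbrs H (insert x (h i) - {u})) < 2 * t * r"
      have "h j \<inter> A (h i) = {}" using I(3) hI(1) i j h_neq[OF i j] by blast
      moreover have "nbrs H (insert x (h i) - {u}) \<subseteq> A (h i)" using u by (auto simp: A_def)
      ultimately show "nbrs H (insert x (h i) - {u}) \<inter> insert x (h j) \<subseteq> insert x (h i)" by auto
    qed simp
    then show False using free by blast
  qed
  then obtain T where T: "finite T" "card T \<le> M * r" "\<forall>q\<in>L. q \<inter> T \<noteq> {}"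
    using matching_or_small_cover[of L r M] sizeL by blast
  have "\<exists>y\<in>e. y \<noteq> x \<and> y \<in> T"
    if "e \<in> H" "edge_weight (2 * t * r) H e < 1 / real t" "x \<in> e" for e
  proof -
    have "e - {x} \<in> L" using that by (auto simp: L_def B_def)
    then have "(e - {x}) \<inter> T \<noteq> {}" using T(3) by blast
    then show ?thesis by blast
  qed
  then show ?thesis using T(1,2) by (auto simp: cover_bound_def M_def d_def)
qed

text \<open>The total weight bounds the number of edges of weight at least \<open>1 / t\<close>,
  giving the main term; the links of the remaining edges have bounded covers, giving the error
  term.\<close>

lemma Fgraph_free_card_le:
  assumes H: "is_rgraph r n H" and free: "\<not> contains_copy H (Fgraph t r)" and "r \<ge> 3" and "t > 0"
  shows "card H \<le> t * (n choose (r - 1)) + (n choose (r - 2)) * (r * cover_bound t r)\<^sup>2"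
proof -
  define B where "B = {e\<in>H. edge_weight (2 * t * r) H e < 1 / real t}"
  have finH: "finite H" by (rule finite_rgraph[OF H])
  obtain T where T: "\<And>x. finite (T x) \<and> card (T x) \<le> cover_bound t r \<and>
    (\<forall>e\<in>H. edge_weight (2 * t * r) H e < 1 / real t \<longrightarrow> x \<in> e \<longrightarrow> (\<exists>y\<in>e. y \<noteq> x \<and> y \<in> T x))"
    using light_edges_link_cover[OF H free _ \<open>t > 0\<close>] \<open>r \<ge> 3\<close> by (metis Suc_leD numeral_3_eq_3 numeral_2_eq_2)
  have "card B \<le> (n choose (r - 2)) * ((r * cover_bound t r) * (r * cover_bound t r))"
    using \<open>r \<ge> 3\<close> H T by (intro card_le_if_links_covered[where T = T]) (auto simp: B_def is_rgraph_def)
  moreover have "card (H - B) \<le> t * (n choose (r - 1))"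
  proof -
    have "real (card (H - B)) * (1 / real t) \<le> (\<Sum>e\<in>H - B. edge_weight (2 * t * r) H e)"
      by (rule sum_bounded_below) (auto simp: B_def)
    also have "\<dots> \<le> (\<Sum>e\<in>H. edge_weight (2 * t * r) H e)"
      using finH by (intro sum_mono2) (auto simp: edge_weight_def intro!: sum_nonneg)
    also have "\<dots> \<le> real (n choose (r - 1))" using sum_edge_weight_le[OF H] \<open>r \<ge> 3\<close> by simp
    finally have "real (card (H - B)) \<le> real (t * (n choose (r - 1)))"
      using \<open>t > 0\<close> by (simp add: field_simps)
    then show ?thesis by linarith
  qed
  moreover have "card H = card (H - B) + card B"
    using finH card_Diff_subset[of B H] card_mono[of H B] by (auto simp: B_def)
  ultimately show ?thesis by (simp add: power2_eq_square)
qed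

section \<open>The lower bound\<close>

text \<open>Splitting off the unique vertex below \<open>t\<close> presents the family as an
  injective image of a product, whose size is immediate.\<close>

definition transversal_rgraph :: "nat \<Rightarrow> nat \<Rightarrow> nat \<Rightarrow> nat set set" where
  "transversal_rgraph t r n =
    (\<lambda>(s, f). insert s f) ` ({..<t} \<times> {f. f \<subseteq> {t..<n} \<and> card f = r - 1})"

lemma is_rgraph_transversal_rgraph:
  assumes "t \<le> n" and "r > 0"
  shows "is_rgraph r n (transversal_rgraph t r n)"
proof -
  have "insert s f \<subseteq> {..<n} \<and> card (insert s f) = r"
    if "s < t" "f \<subseteq> {t..<n}" "card f = r - 1" for s f
  proof -
    have "s \<notin> f" "finite f" using that finite_subset[of f "{t..<n}"] by auto
    then show ?thesis using that assms by auto
  qed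
  then show ?thesis by (auto simp: is_rgraph_def transversal_rgraph_def)
qed

lemma card_transversal_rgraph: "card (transversal_rgraph t r n) = t * ((n - t) choose (r - 1))"
proof -
  have "inj_on (\<lambda>(s, f). insert s f) ({..<t} \<times> {f. f \<subseteq> {t..<n} \<and> card f = r - 1})"
  proof (rule inj_onI, clarsimp)
    fix s f s' f'
    assume *: "s < t" "s' < t" "f \<subseteq> {t..<n}" "f' \<subseteq> {t..<n}" "insert s f = insert s' f'"
    then have "s = s'" "s \<notin> f" "s' \<notin> f'" by (fastforce)+
    then show "s = s' \<and> f = f'" using *(5) by auto
  qed
  then show ?thesis
    unfolding transversal_rgraph_def using n_subsets[of "{t..<n}"]
    by (simp add: card_image card_cartesian_product)
qed

text \<open>If \<open>Ctr\<close> lies in \<open>S\<close>, no other clique vertex does, so every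
  edge missing \<open>Ctr\<close> is hit at its pendant vertex: \<open>t\<close> vertices besides
  \<open>Ctr\<close>. Otherwise every copy contributes two vertices of its own, and
  \<open>2 * t > t\<close>.\<close>

lemma crosscut_Fgraph:
  assumes "r \<ge> 3" and "t > 0" and "finite S"
    and cut: "\<And>e. e \<in> Fgraph t r \<Longrightarrow> \<exists>v. e \<inter> S = {v}"
  shows "t < card S"
proof -
  have edge: "\<exists>w. insert (Pend i v) (Kcopy r i - {v}) \<inter> S = {w}" if "i < t" "v \<in> Kcopy r i" for i v
    using that by (intro cut) (auto simp: Fgraph_def)
  have Ctr_K: "Ctr \<in> Kcopy r i" for i by (simp add: Kcopy_def)
  have Priv_K: "Priv i j \<in> Kcopy r i" if "j < r - 1" for i j using that by (auto simp: Kcopy_def)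
  show ?thesis
  proof (cases "Ctr \<in> S")
    case True
    have "Pend i Ctr \<in> S" if "i < t" for i
    proof -
      have "Priv i j \<notin> S" if j: "j < r - 1" for j
      proof
        assume "Priv i j \<in> S"
        \<comment> \<open>A further private vertex, available since \<open>r - 1 \<ge> 2\<close>:
          the edge missing it contains both \<open>Ctr\<close> and \<open>Priv i j\<close>.\<close>
        define j' where "j' = (if j = 0 then 1 else 0 :: nat)"
        have j': "j' < r - 1" "j' \<noteq> j" using \<open>r \<ge> 3\<close> by (auto simp: j'_def)
        obtain w where "insert (Pend i (Priv i j')) (Kcopy r i - {Priv i j'}) \<inter> S = {w}"
          using edge[OF \<open>i < t\<close> Priv_K[OF j'(1)]] by blast
        moreover have "{Ctr, Priv i j} \<subseteq> insert (Pend i (Priv i j')) (Kcopy r i - {Priv i j'}) \<inter> S"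
          using True \<open>Priv i j \<in> S\<close> Ctr_K Priv_K[OF j] j' by auto
        ultimately show False by auto
      qed
      then have "(Kcopy r i - {Ctr}) \<inter> S = {}" by (auto simp: Kcopy_def)
      moreover obtain w where "w \<in> insert (Pend i Ctr) (Kcopy r i - {Ctr}) \<inter> S"
        using edge[OF \<open>i < t\<close> Ctr_K] by blast
      ultimately show ?thesis by blast
    qed
    then have "insert Ctr ((\<lambda>i. Pend i Ctr) ` {..<t}) \<subseteq> S" using True by auto
    then have "card (insert Ctr ((\<lambda>i. Pend i Ctr) ` {..<t})) \<le> card S"
      using \<open>finite S\<close> by (rule card_mono[rotated])
    moreover have "Ctr \<notin> (\<lambda>i. Pend i Ctr) ` {..<t}" by auto
    ultimately show ?thesis by (simp add: card_image inj_on_def)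
  next
    case False
    \<comment> \<open>\<open>idx\<close> names the copy to which a vertex belongs. The value at
      \<open>Ctr\<close> is a default, as \<open>Ctr\<close> is outside \<open>S\<close> in this
      case.\<close>
    define idx where "idx v = (case v of Ctr \<Rightarrow> 0 | Priv i j \<Rightarrow> i | Pend i w \<Rightarrow> i)" for v
    have idx_K: "idx v = i" if "v \<in> insert (Pend i w) (Kcopy r i)" "v \<in> S" for v w i
      using that False by (auto simp: Kcopy_def idx_def)
    have "\<exists>a b. a \<in> S \<and> b \<in> S \<and> a \<noteq> b \<and> idx a = i \<and> idx b = i" if i: "i < t" for i
    proof -
      obtain a where a: "a \<in> insert (Pend i Ctr) (Kcopy r i - {Ctr})" "a \<in> S"
        using edge[OF i Ctr_K] by blast
      \<comment> \<open>The vertex \<open>v\<close> is chosen so that the edge missing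
        \<open>v\<close> avoids \<open>a\<close>; that edge must then be hit at a second vertex
        \<open>b\<close>.\<close>
      have "\<exists>v \<in> Kcopy r i. v \<noteq> Ctr \<and> (a \<in> Kcopy r i \<longrightarrow> v = a)"
        using a Priv_K[of 0 i] \<open>r \<ge> 3\<close> by (cases "a \<in> Kcopy r i") auto
      then obtain v where v: "v \<in> Kcopy r i" "v \<noteq> Ctr" "a \<in> Kcopy r i \<Longrightarrow> v = a" by blast
      obtain b where b: "b \<in> insert (Pend i v) (Kcopy r i - {v})" "b \<in> S"
        using edge[OF i v(1)] by blast
      have "a \<noteq> b"
      proof
        assume "a = b"
        then have "b = Pend i v" using b(1) v(3) by auto
        then show False using a(1) \<open>a = b\<close> v(2) by (auto simp: Kcopy_def)
      qed
      moreover have "idx a = i" "idx b = i" using idx_K a b by blast+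
      ultimately show ?thesis using a b by blast
    qed
    then obtain a b where ab: "\<And>i. i < t \<Longrightarrow>
        a i \<in> S \<and> b i \<in> S \<and> a i \<noteq> b i \<and> idx (a i) = i \<and> idx (b i) = i" by metis
    have "inj_on a {..<t}" "inj_on b {..<t}" using ab by (metis inj_onI lessThan_iff)+
    moreover have "a ` {..<t} \<inter> b ` {..<t} = {}"
    proof -
      have "a i \<noteq> b j" if "i < t" "j < t" for i j using ab that by metis
      then show ?thesis by auto
    qed
    ultimately have "card (a ` {..<t} \<union> b ` {..<t}) = 2 * t"
      by (simp add: card_Un_disjoint card_image)
    moreover have "card (a ` {..<t} \<union> b ` {..<t}) \<le> card S"
      using ab \<open>finite S\<close> by (intro card_mono) auto
    ultimately show ?thesis using \<open>t > 0\<close> by simp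
  qed
qed

text \<open>The preimage of \<open>{..<t}\<close> under an embedding meets every edge exactly once
  but has at most \<open>t\<close> elements, against the crosscut bound.\<close>

lemma transversal_rgraph_Fgraph_free:
  assumes "r \<ge> 3" and "t > 0"
  shows "\<not> contains_copy (transversal_rgraph t r n) (Fgraph t r)"
proof
  assume "contains_copy (transversal_rgraph t r n) (Fgraph t r)"
  then obtain f where f: "inj_on f (\<Union>(Fgraph t r))"
      "\<And>e. e \<in> Fgraph t r \<Longrightarrow> f ` e \<in> transversal_rgraph t r n"
    unfolding contains_copy_def by blast
  define S where "S = {v \<in> \<Union>(Fgraph t r). f v < t}"
  have inj: "inj_on f S" using f(1) by (rule inj_on_subset) (auto simp: S_def)
  have sub: "f ` S \<subseteq> {..<t}" by (auto simp: S_def)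
  have "finite S" using inj sub finite_subset[of "f ` S" "{..<t}"] by (simp add: finite_image_iff)
  moreover have "\<exists>v. e \<inter> S = {v}" if e: "e \<in> Fgraph t r" for e
  proof -
    obtain s q where sq: "f ` e = insert s q" "s < t" "q \<subseteq> {t..<n}"
      using f(2)[OF e] by (auto simp: transversal_rgraph_def)
    then obtain v where v: "v \<in> e" "f v = s" by (metis imageE insertI1)
    have "w = v" if "w \<in> e \<inter> S" for w
    proof -
      have "f w \<in> insert s q" "f w < t" using that sq(1) by (auto simp: S_def)
      then have "f w = f v" using sq(3) v(2) by auto
      then show ?thesis using inj_onD[OF f(1)] that v(1) e by blast
    qed
    moreover have "v \<in> S" using v e sq(2) by (auto simp: S_def)
    ultimately show ?thesis using v(1) by blast
  qed
  ultimately have "t < card S" using assms by (intro crosscut_Fgraph)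
  moreover have "card S \<le> t" using card_inj_on_le[OF inj sub] by simp
  ultimately show False by simp
qed

section \<open>The asymptotics of the extremal number\<close>

text \<open>For nonempty \<open>G\<close> the empty hypergraph is \<open>G\<close>-free, so the
  \<open>Max\<close> in \<open>ex_r\<close> ranges over a nonempty finite set.\<close>

lemma ex_r_bounds:
  assumes "G \<noteq> {}"
  shows ex_r_ge: "is_rgraph r n H \<Longrightarrow> \<not> contains_copy H G \<Longrightarrow> card H \<le> ex_r r n G"
    and ex_r_le: "(\<And>H. is_rgraph r n H \<Longrightarrow> \<not> contains_copy H G \<Longrightarrow> card H \<le> m) \<Longrightarrow> ex_r r n G \<le> m"
proof -
  let ?A = "{card H | H. is_rgraph r n H \<and> \<not> contains_copy H G}"
  have "?A \<subseteq> card ` Pow (Pow {..<n})" by (auto simp: is_rgraph_def)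
  then have fin: "finite ?A" by (rule finite_subset) simp
  have "is_rgraph r n {} \<and> \<not> contains_copy {} G"
    using assms by (auto simp: is_rgraph_def contains_copy_def)
  then have ne: "?A \<noteq> {}" by blast
  show "is_rgraph r n H \<Longrightarrow> \<not> contains_copy H G \<Longrightarrow> card H \<le> ex_r r n G"
    unfolding ex_r_def using fin by (intro Max_ge) auto
  show "(\<And>H. is_rgraph r n H \<Longrightarrow> \<not> contains_copy H G \<Longrightarrow> card H \<le> m) \<Longrightarrow> ex_r r n G \<le> m"
    unfolding ex_r_def using fin ne by (subst Max_le_iff) auto
qed

lemma choose_le_pow: "n choose k \<le> n ^ k" for n k :: nat
  using binomial_le_pow[of k n] by (cases "k \<le> n") (auto simp: binomial_eq_0)

text \<open>Pascal's rule applied \<open>s\<close> times, each extra term being bounded by the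
  largest one.\<close>

lemma choose_add_le: "(m + s) choose Suc k \<le> (m choose Suc k) + s * ((m + s) choose k)" for m s k :: nat
proof (induction s)
  case (Suc s)
  have "(m + s) choose k \<le> (m + Suc s) choose k" by (rule binomial_right_mono) simp
  then have "s * ((m + s) choose k) + ((m + s) choose k) \<le> Suc s * ((m + Suc s) choose k)"
    by (simp add: add_mono add.commute)
  then show ?case using Suc by simp
qed simp

theorem theorem2:
  fixes r t :: nat
  assumes "r \<ge> 3" and "t > 1"
  shows "(\<lambda>n. real (ex_r r n (Fgraph t r)) - real t * real (n choose (r - 1)))
           \<in> O(\<lambda>n. real n ^ (r - 2))"
proof -
  \<comment> \<open>The square comes from the edges of small weight in the upper bound, and
    \<open>t * t\<close> from replacing \<open>n\<close> by \<open>n - t\<close> in the lower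
    bound.\<close>
  define C where "C = (r * cover_bound t r)\<^sup>2 + t * t"
  have t: "t > 0" using assms by simp
  have ne: "Fgraph t r \<noteq> {}" using t by (auto simp: Fgraph_def Kcopy_def)
  \<comment> \<open>From \<open>n = t\<close> on, the construction for the lower bound fits into
    \<open>n\<close> vertices.\<close>
  have "norm (real (ex_r r n (Fgraph t r)) - real t * real (n choose (r - 1)))
      \<le> real C * norm (real n ^ (r - 2))" if n: "t \<le> n" for n
  proof -
    define E where "E = ex_r r n (Fgraph t r)"
    have "E \<le> t * (n choose (r - 1)) + (n choose (r - 2)) * (r * cover_bound t r)\<^sup>2"
      unfolding E_def using Fgraph_free_card_le[OF _ _ assms(1) t] by (intro ex_r_le[OF ne])
    also have "\<dots> \<le> t * (n choose (r - 1)) + n ^ (r - 2) * (r * cover_bound t r)\<^sup>2"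
      using choose_le_pow by simp
    also have "\<dots> \<le> t * (n choose (r - 1)) + C * n ^ (r - 2)"
      by (simp add: C_def algebra_simps)
    finally have upper: "E \<le> t * (n choose (r - 1)) + C * n ^ (r - 2)" .
    have k: "r - 1 = Suc (r - 2)" using assms(1) by simp
    have "t * ((n - t) choose (r - 1)) \<le> E"
      unfolding E_def card_transversal_rgraph[symmetric]
      using assms n t transversal_rgraph_Fgraph_free is_rgraph_transversal_rgraph
      by (intro ex_r_ge[OF ne]) auto
    moreover have "n choose (r - 1) \<le> ((n - t) choose (r - 1)) + t * (n choose (r - 2))"
      using choose_add_le[of "n - t" t "r - 2"] n unfolding k by simp
    then have "t * (n choose (r - 1)) \<le> t * ((n - t) choose (r - 1)) + t * t * (n choose (r - 2))"
      by (metis add_mult_distrib2 mult.assoc mult_le_mono2)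
    moreover have "t * t * (n choose (r - 2)) \<le> C * n ^ (r - 2)"
      by (rule mult_le_mono) (simp_all add: C_def choose_le_pow)
    ultimately have lower: "t * (n choose (r - 1)) \<le> E + C * n ^ (r - 2)" by linarith
    have "real E \<le> real t * real (n choose (r - 1)) + real C * real n ^ (r - 2)"
      using of_nat_mono[OF upper, where ?'a = real] by simp
    moreover have "real t * real (n choose (r - 1)) \<le> real E + real C * real n ^ (r - 2)"
      using of_nat_mono[OF lower, where ?'a = real] by simp
    ultimately show ?thesis unfolding E_def[symmetric] by (simp add: abs_le_iff)
  qed
  then show ?thesis
    by (intro bigoI[of _ "real C"] eventually_sequentiallyI[of t])
qed

end
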